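(* There is an infinite word $\mathbf{w}$ over the binary alphabet $\{0,1\}$ such that $\mathbf{w}$ is $(5/2)^+$-free and its curling-number transform $C(\mathbf{w})$ is $3^+$-free.
   Context: Words are indexed from $0$; infinite words are one-sided, $\mathbf{w} = \mathbf{w}[0]\mathbf{w}[1]\cdots$; $x[i..j]$ denotes the factor (contiguous block) $x[i]\cdots x[j]$. A finite word $x$ of length $n \ge 1$ has period $p$, $1\le p\le n$, if $x[i]=x[i+p]$ for all $0\le i<n-p$; its exponent is $n/p$ where $p$ is its least period. A finite or infinite word is $\alpha^+$-free if it has no nonempty finite factor of exponent strictly greater than $\alpha$. The curling number of a nonempty finite word $u$ is the largest integer $k \ge 1$ such that $u = y z^k$ for some (possibly empty) word $y$ and some nonempty word $z$. For a finite or infinite word $x$, the curling-number transform $C(x)$ is the word over the positive integers, of the same length as $x$, whose $i$-th letter $C(x)[i]$ is the curling number of the prefix $x[0..i]$. *)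

theory Defs
  imports Complex_Main "HOL-Library.Omega_Words_Fun"
begin

text \<open>
  Finite words are lists, infinite words are functions on \<^typ>\<open>nat\<close>. The factor
  \<open>w[i..j]\<close> with both ends included is \<^term>\<open>w [i \<rightarrow> Suc j]\<close>.
\<close>

definition has_period :: "nat \<Rightarrow> 'a list \<Rightarrow> bool" where
  "has_period p x \<longleftrightarrow>
     1 \<le> p \<and> p \<le> length x \<and> (\<forall>i < length x - p. x ! i = x ! (i + p))"

text \<open>
  \<^term>\<open>length x\<close> is always a period of a nonempty word, so the least period exists;
  the exponent of the empty word is not meaningful.
\<close>

definition exponent :: "'a list \<Rightarrow> real" where
  "exponent x = real (length x) / real (LEAST p. has_period p x)"

definition plus_free :: "real \<Rightarrow> 'a word \<Rightarrow> bool" where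
  "plus_free \<alpha> w \<longleftrightarrow>
     (\<nexists>x i j. x = (w [i \<rightarrow> j]) \<and> x \<noteq> [] \<and> exponent x > \<alpha>)"

text \<open>
  For nonempty \<open>u\<close> the values of \<open>k\<close> below include \<open>1\<close> and are at most \<^term>\<open>length u\<close>,
  so there is a greatest one.
\<close>

definition curling_number :: "'a list \<Rightarrow> nat" where
  "curling_number u =
     (GREATEST k. 1 \<le> k \<and> (\<exists>y z. z \<noteq> [] \<and> u = y @ concat (replicate k z)))"

definition curling_transform :: "'a word \<Rightarrow> nat word" where
  "curling_transform w = (\<lambda>i. curling_number (w [0 \<rightarrow> Suc i]))"

end

theory Submission
  imports Defs
begin

text \<open>
  Let \<open>u\<close> be a squarefree ternary word, here the fixed point of an 11-uniform morphism. The word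
  \<open>w\<close> is the image of \<open>u\<close> under a 49-uniform morphism \<open>g\<close> found by computer search, chosen so that
  \<open>w\<close> has no cubes and only squares of period at most 5. Then \<open>C(w)[i]\<close> is 2 or 1 according to
  whether a square of period at most 5 ends at \<open>i\<close>. The images of the letters end in a common word
  of length 10, so this does not depend on the preceding block, and wherever a square crossing
  the block boundary ends, another one inside the block ends too, so the first block is no
  exception. Hence \<open>C(w)\<close> is the image of \<open>u\<close> under a second 49-uniform morphism.

  For all three morphisms \<open>f\<close>, of block length \<open>k\<close>, a repetition in \<open>f(u)\<close> of period at least
  \<open>2k - 1\<close> contains a full block within its first period; synchronization makes the period a multiple
  of \<open>k\<close>, and the repetition descends to a square in \<open>u\<close>. Shorter repetitions lie in the image of a
  squarefree word of length 5, which leaves a finite computation.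
\<close>

section \<open>Repetitions as shifted agreements, and a search for them in finite words\<close>

definition matches :: "'a word \<Rightarrow> nat \<Rightarrow> nat \<Rightarrow> nat \<Rightarrow> bool" where
  "matches w i p n \<longleftrightarrow> (\<forall>j<n. w (i + j) = w (i + j + p))"

lemma matches_mono: "matches w i p n \<Longrightarrow> m \<le> n \<Longrightarrow> matches w i p m"
  by (simp add: matches_def)

text \<open>The bound N serves the induction in \<open>squarefree_sqf_word\<close>, where only a
  shorter prefix is known to be squarefree.\<close>

definition squarefree_upto :: "nat \<Rightarrow> 'a word \<Rightarrow> bool" where
  "squarefree_upto N u \<longleftrightarrow> (\<forall>i p. 0 < p \<longrightarrow> i + 2 * p \<le> N \<longrightarrow> \<not> matches u i p p)"

text \<open>\<open>has_run n n xs ys\<close> looks for \<open>n\<close> consecutive positions where \<open>xs\<close> and \<open>ys\<close> agree; the second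
  argument counts the agreements still missing.\<close>

fun has_run :: "nat \<Rightarrow> nat \<Rightarrow> 'a list \<Rightarrow> 'a list \<Rightarrow> bool" where
  "has_run n 0 xs ys \<longleftrightarrow> True"
| "has_run n (Suc c) (x # xs) (y # ys) \<longleftrightarrow> has_run n (if x = y then c else n) xs ys"
| "has_run n (Suc c) _ _ \<longleftrightarrow> False"

lemma has_run_prefix:
  assumes "c \<le> length xs" "c \<le> length ys" "\<And>j. j < c \<Longrightarrow> xs ! j = ys ! j"
  shows "has_run n c xs ys"
  using assms
proof (induction c arbitrary: xs ys)
  case (Suc c)
  then obtain x xs' y ys' where eq: "xs = x # xs'" "ys = y # ys'"
    by (metis Suc_le_length_iff)
  have "has_run n c xs' ys'"
  proof (rule Suc.IH)
    show "xs' ! j = ys' ! j" if "j < c" for j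
      using Suc.prems(3)[of "Suc j"] that by (simp add: eq)
  qed (use Suc.prems eq in auto)
  then show ?case using Suc.prems(3)[of 0] by (simp add: eq)
qed simp

text \<open>The letters before position i may leave the counter at any value up to n, so the
  induction runs over a general c.\<close>

lemma has_run_infix:
  assumes "c \<le> n" "i + n \<le> length xs" "i + n \<le> length ys"
    and "\<And>j. j < n \<Longrightarrow> xs ! (i + j) = ys ! (i + j)"
  shows "has_run n c xs ys"
  using assms
proof (induction i arbitrary: xs ys c)
  case 0
  then show ?case by (intro has_run_prefix) auto
next
  case (Suc i)
  show ?case
  proof (cases c)
    case c: (Suc d)
    from Suc.prems(2,3) obtain x xs' y ys' where eq: "xs = x # xs'" "ys = y # ys'"
      by (cases xs; cases ys) auto
    have "has_run n e xs' ys'" if "e \<le> n" for e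
      using Suc.prems eq that by (intro Suc.IH) auto
    then show ?thesis using c eq Suc.prems(1) by simp
  qed simp
qed

text \<open>A run of \<open>t p\<close> agreements of x with its shift by p is a repetition of
  period p and length \<open>t p + p\<close>. Listing the periods lets rewriting evaluate the
  check.\<close>

definition avoids :: "(nat \<Rightarrow> nat) \<Rightarrow> nat \<Rightarrow> 'a list \<Rightarrow> bool" where
  "avoids t K x \<longleftrightarrow> (\<forall>p\<in>set [1..<K]. \<not> has_run (t p) (t p) x (drop p x))"

lemma avoidsD:
  assumes "avoids t K x" "0 < p" "p < K" "i + t p + p \<le> length x"
  shows "\<exists>j<t p. x ! (i + j) \<noteq> x ! (i + j + p)"
proof (rule ccontr)
  assume "\<not> ?thesis"
  then have "has_run (t p) (t p) x (drop p x)"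
    using assms(4) by (intro has_run_infix[where i = i]) (auto simp: add.commute add.left_commute)
  then show False using assms by (auto simp: avoids_def)
qed

section \<open>Squarefree ternary words of length 5\<close>

datatype letter = A | B | C

definition letters :: "letter list" where
  "letters = [A, B, C]"

lemma in_letters [simp]: "a \<in> set letters"
  by (cases a) (simp_all add: letters_def)

text \<open>A square within five letters has period 1, at four possible positions, or period 2, at
  two.\<close>

fun squarefree5 :: "'a list \<Rightarrow> bool" where
  "squarefree5 [a, b, c, d, e] \<longleftrightarrow>
     a \<noteq> b \<and> b \<noteq> c \<and> c \<noteq> d \<and> d \<noteq> e \<and> \<not> (a = c \<and> b = d) \<and> \<not> (b = d \<and> c = e)"
| "squarefree5 _ \<longleftrightarrow> False"

definition words5 :: "letter list list" where
  "words5 = filter squarefree5 (List.n_lists 5 letters)"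

lemma window_words5:
  assumes "squarefree_upto N u" "e + 5 \<le> N"
  shows "map u [e..<e + 5] \<in> set words5"
proof -
  have ne: "\<not> matches u (e + i) p p" if "0 < p" "i + 2 * p \<le> 5" for i p
    using assms that by (auto simp: squarefree_upto_def)
  have eq: "map u [e..<e + 5] = [u e, u (e + 1), u (e + 2), u (e + 3), u (e + 4)]"
    by (simp add: upt_rec numeral_eq_Suc)
  have "squarefree5 (map u [e..<e + 5])"
    unfolding eq using ne[of 1 0] ne[of 1 1] ne[of 1 2] ne[of 1 3] ne[of 2 0] ne[of 2 1]
    by (auto simp: matches_def less_Suc_eq numeral_eq_Suc)
  moreover have "map u [e..<e + 5] \<in> set (List.n_lists 5 letters)"
    by (auto simp: set_n_lists)
  ultimately show ?thesis by (simp add: words5_def)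
qed

section \<open>Repetitions in uniform images\<close>

definition uniform_image :: "nat \<Rightarrow> ('a \<Rightarrow> 'b list) \<Rightarrow> 'a word \<Rightarrow> 'b word" where
  "uniform_image k f u n = f (u (n div k)) ! (n mod k)"

lemma uniform_image_block: "j < k \<Longrightarrow> uniform_image k f u (m * k + j) = f (u m) ! j"
  by (simp add: uniform_image_def)

lemma nth_concat_uniform:
  assumes "\<And>a. length (f a) = k" "x < length v * k"
  shows "concat (map f v) ! x = f (v ! (x div k)) ! (x mod k)"
  using assms(2)
proof (induction v arbitrary: x)
  case (Cons a v)
  have k: "0 < k" using Cons.prems by (cases k) auto
  show ?case
  proof (cases "x < k")
    case False
    then have "concat (map f v) ! (x - k) = f (v ! ((x - k) div k)) ! ((x - k) mod k)"
      using Cons.prems by (intro Cons.IH) auto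
    moreover have "x div k = Suc ((x - k) div k)" "x mod k = (x - k) mod k"
      using False k by (simp_all add: le_div_geq le_mod_geq)
    ultimately show ?thesis using False assms(1) by (simp add: nth_append)
  qed (simp add: nth_append assms(1))
qed simp

lemma uniform_image_window:
  assumes "\<And>a. length (f a) = k" "x < n * k"
  shows "uniform_image k f u (e * k + x) = concat (map f (map u [e..<e + n])) ! x"
proof -
  have "0 < k" using assms(2) by (cases k) auto
  then have "(e * k + x) div k = e + x div k" "x div k < n"
    using assms(2) by (auto simp: less_mult_imp_div_less)
  then show ?thesis
    using assms by (subst nth_concat_uniform[OF assms(1)]) (auto simp: uniform_image_def)
qed

text \<open>Repetitions survive a letter-to-letter coding, so excluding them for the Boolean coding
  excludes them for the numeric words.\<close>

lemma matches_uniform_image_map: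
  assumes "matches (uniform_image k f u) i p n" "\<And>a. length (f a) = k" "0 < k"
  shows "matches (uniform_image k (\<lambda>a. map \<phi> (f a)) u) i p n"
proof -
  have "uniform_image k (\<lambda>a. map \<phi> (f a)) u x = \<phi> (uniform_image k f u x)" for x
    using assms(2,3) by (simp add: uniform_image_def)
  then show ?thesis using assms(1) by (simp add: matches_def)
qed

text \<open>
  A factor of period \<open>p\<close> with \<open>n\<close> matches has length \<open>n + p\<close>; \<open>t p\<close> is the number of matches to be
  excluded for period \<open>p\<close>. The assumption \<open>border\<close> treats squares starting inside a block: it
  forces one of the two partial blocks at the ends to agree completely with its shifted copy. Its
  case \<open>r = 0\<close>, \<open>c = a\<close> says that \<open>f\<close> is injective.
\<close>

locale uniform_morphism =
  fixes f :: "letter \<Rightarrow> 'b list" and k :: nat and t :: "nat \<Rightarrow> nat"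
  assumes k_pos: "0 < k"
    and len: "\<And>a. length (f a) = k"
    and sync: "\<And>a b c r. a \<noteq> b \<Longrightarrow> r \<in> {1..<k} \<Longrightarrow> take k (drop r (f a @ f b)) \<noteq> f c"
    and border: "\<And>a b c r. a \<noteq> b \<Longrightarrow> b \<noteq> c \<Longrightarrow> r \<in> {0..<k} \<Longrightarrow>
      take r (f b) = take r (f c) \<Longrightarrow> drop r (f b) \<noteq> drop r (f a)"
    and windows: "\<And>v. v \<in> set words5 \<Longrightarrow> avoids t (2 * k - 1) (concat (map f v))"
    and t_ge: "\<And>p. p \<le> t p"
    and t_le: "\<And>p. p < 2 * k - 1 \<Longrightarrow> t p + p \<le> 4 * k"
begin

lemma inj: "f a = f b \<Longrightarrow> a = b"
  using border[of a b a 0] k_pos by auto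

lemma block_eqI: "(\<And>j. j < k \<Longrightarrow> f a ! j = f b ! j) \<Longrightarrow> a = b"
  by (rule inj) (simp add: list_eq_iff_nth_eq len)

text \<open>Since \<open>t p + p\<close> is at most 4k, the repetition lies in five consecutive
  blocks, where \<open>windows\<close> applies.\<close>

lemma short_period:
  assumes sq: "squarefree_upto N u" and N: "5 \<le> N"
    and p: "0 < p" "p < 2 * k - 1" and le: "i + t p + p \<le> N * k"
  shows "\<not> matches (uniform_image k f u) i p (t p)"
proof
  assume m: "matches (uniform_image k f u) i p (t p)"
  \<comment> \<open>Near the end the window is moved left, so that its five letters stay among the
    first N, where u is known to be squarefree.\<close>
  define e where "e = min (i div k) (N - 5)"
  define x where "x = i - e * k"
  have "e * k \<le> i div k * k" by (simp add: e_def)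
  also have "\<dots> \<le> i" by (simp add: div_times_less_eq_dividend)
  finally have i: "i = e * k + x" by (simp add: x_def)
  have x: "x + t p + p \<le> 5 * k"
  proof (cases "i div k \<le> N - 5")
    case True
    then have "x = i mod k" by (simp add: x_def e_def minus_div_mult_eq_mod)
    then have "x < k" using k_pos by simp
    then show ?thesis using t_le[OF p(2)] by simp
  next
    case False
    then have "e = N - 5" by (simp add: e_def)
    then have "e * k + 5 * k = N * k" using N by (simp flip: distrib_right)
    then show ?thesis using le i by simp
  qed
  define v where "v = map u [e..<e + 5]"
  have eN: "e + 5 \<le> N" using N by (simp add: e_def)
  have lenv: "length (concat (map f v)) = 5 * k"
    by (simp add: length_concat v_def len comp_def sum_list_triv)
  have "avoids t (2 * k - 1) (concat (map f v))"
    unfolding v_def by (intro windows window_words5[OF sq eN])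
  from avoidsD[OF this p, of x] obtain j where j: "j < t p"
    and ne: "concat (map f v) ! (x + j) \<noteq> concat (map f v) ! (x + j + p)"
    using x lenv by auto
  have "uniform_image k f u (e * k + y) = concat (map f v) ! y" if "y < 5 * k" for y
    unfolding v_def using that by (intro uniform_image_window len)
  from this[of "x + j"] this[of "x + j + p"]
  have "uniform_image k f u (i + j) \<noteq> uniform_image k f u (i + j + p)"
    using ne x j by (simp add: i add.assoc)
  then show False using m j by (auto simp: matches_def)
qed

lemma long_period:
  assumes sq: "squarefree_upto N u" and p: "2 * k - 1 \<le> p" and le: "i + 2 * p \<le> N * k"
  shows "\<not> matches (uniform_image k f u) i p p"
proof
  let ?w = "uniform_image k f u"
  assume "matches ?w i p p"
  then have w: "?w x = ?w (x + p)" if "i \<le> x" "x < i + p" for x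
    using that unfolding matches_def by (metis le_add_diff_inverse nat_add_left_cancel_less)
  have p0: "0 < p" using p k_pos by linarith
  note [simp] = uniform_image_block
  \<comment> \<open>Block m is the first to start at or after i; the lower bound on p places it
    inside the first period.\<close>
  define m where "m = (i + k - 1) div k"
  have m: "i \<le> m * k" "m * k + k \<le> i + p"
  proof -
    have "(i + k - 1) mod k < k" using k_pos by simp
    moreover have "m * k + (i + k - 1) mod k = i + k - 1" by (simp add: m_def)
    ultimately show "i \<le> m * k" "m * k + k \<le> i + p" using p k_pos by linarith+
  qed
  have "k dvd p"
  proof (rule ccontr)
    assume "\<not> k dvd p"
    then have r: "p mod k \<in> {1..<k}" using k_pos by (auto simp: dvd_eq_mod_eq_0)
    \<comment> \<open>The copy of block m, shifted by p, starts at offset r of block s and overlaps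
      blocks s and s + 1.\<close>
    define s where "s = m + p div k"
    define r where "r = p mod k"
    have mp: "m * k + p = s * k + r" by (simp add: s_def r_def algebra_simps)
    \<comment> \<open>The copy ends at \<open>s * k + r + k\<close>, which is at most
      \<open>N * k\<close>. As r > 0, the inequality is strict and s + 1 is an index below
      N.\<close>
    have "s * k + k < N * k"
      using mp r m le unfolding r_def by simp
    then have "(s + 1) * k < N * k" by simp
    then have "s + 1 < N" by (simp only: mult_less_cancel2)
    then have sN: "s + 2 \<le> N" by simp
    have "u s \<noteq> u (s + 1)"
    proof
      assume "u s = u (s + 1)"
      then have "matches u s 1 1" by (simp add: matches_def)
      then show False using sq sN by (auto simp: squarefree_upto_def)
    qed
    moreover have rk: "r \<le> length (f (u s) @ f (u (s + 1)))"
      using r by (simp add: r_def len)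
    moreover have "take k (drop r (f (u s) @ f (u (s + 1)))) = f (u m)"
    proof (rule nth_equalityI)
      fix j assume "j < length (take k (drop r (f (u s) @ f (u (s + 1)))))"
      then have j: "j < k" by simp
      have "f (u m) ! j = ?w (m * k + j)" using j by simp
      also have "\<dots> = ?w (m * k + j + p)" using m j by (intro w) auto
      also have "m * k + j + p = s * k + (r + j)" using mp by simp
      also have "?w \<dots> = (f (u s) @ f (u (s + 1))) ! (r + j)"
      proof (cases "r + j < k")
        case False
        have "s * k + (r + j) = (s + 1) * k + (r + j - k)" using False by simp
        moreover have "r < k" using k_pos by (simp add: r_def)
        then have "r + j - k < k" using j by simp
        ultimately show ?thesis using False by (simp only: uniform_image_block)
            (simp add: nth_append len)
      qed (simp add: nth_append len)
      also have "\<dots> = take k (drop r (f (u s) @ f (u (s + 1)))) ! j"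
        using j rk by (simp only: nth_take nth_drop)
      finally show "take k (drop r (f (u s) @ f (u (s + 1)))) ! j = f (u m) ! j" ..
    qed (use r in \<open>simp add: len r_def\<close>)
    ultimately show False using sync r unfolding r_def by blast
  qed
  then obtain q where q: "p = q * k" by (metis dvd_def mult.commute)
  have q0: "0 < q" using p0 q by (cases q) auto
  define e where "e = i div k"
  define s where "s = i mod k"
  have i: "i = e * k + s" and s: "s < k" using k_pos by (simp_all add: e_def s_def)
  have full: "u n = u (n + q)" if "i \<le> n * k" "n * k + k \<le> i + p" for n
  proof (rule block_eqI)
    fix j assume j: "j < k"
    have "?w (n * k + j) = ?w (n * k + j + p)" using that j by (intro w) auto
    also have "n * k + j + p = (n + q) * k + j" by (simp add: q algebra_simps)
    finally show "f (u n) ! j = f (u (n + q)) ! j" using j by simp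
  qed
  have inner: "u n = u (n + q)" if "e < n" "n < e + q" for n
  proof (rule full)
    have "(e + 1) * k \<le> n * k" "(n + 1) * k \<le> (e + q) * k"
      using that by (intro mult_le_mono1; simp)+
    then show "i \<le> n * k" "n * k + k \<le> i + p" using i s q by (simp_all add: algebra_simps)
  qed
  have "(e + 2 * q) * k + s \<le> N * k" using le i q by (simp add: algebra_simps)
  then have eN: "e + 2 * q \<le> N" and eN': "0 < s \<Longrightarrow> e + 2 * q + 1 \<le> N"
  proof -
    assume le': "(e + 2 * q) * k + s \<le> N * k"
    then have "(e + 2 * q) * k \<le> N * k" by linarith
    then show "e + 2 * q \<le> N" using k_pos by simp
    assume "0 < s"
    then have "(e + 2 * q) * k < N * k" using le' by linarith
    then show "e + 2 * q + 1 \<le> N" by simp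
  qed
  \<comment> \<open>Otherwise u has a square of period q starting at e.\<close>
  have first: "u e \<noteq> u (e + q)"
  proof
    assume "u e = u (e + q)"
    then have "u (e + j) = u (e + j + q)" if "j < q" for j
      using inner[of "e + j"] that by (cases j) auto
    then show False using sq q0 eN by (auto simp: squarefree_upto_def matches_def)
  qed
  have s0: "0 < s"
  proof (rule ccontr)
    assume "\<not> 0 < s"
    then have "u e = u (e + q)"
      using i q q0 by (intro full) auto
    then show False using first by blast
  qed
  \<comment> \<open>Otherwise u has a square of period q starting at e + 1. Its last index e + 2q is
    below N because s > 0.\<close>
  have last: "u (e + q) \<noteq> u (e + q + q)"
  proof
    assume eq: "u (e + q) = u (e + q + q)"
    have "u (e + 1 + j) = u (e + 1 + j + q)" if "j < q" for j
    proof (cases "Suc j = q")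
      case True
      then show ?thesis using eq by (metis add.assoc plus_1_eq_Suc)
    qed (use inner[of "e + 1 + j"] that in auto)
    then have "matches u (e + 1) q q" by (simp add: matches_def)
    then show False using sq q0 eN'[OF s0] by (auto simp: squarefree_upto_def)
  qed
  \<comment> \<open>Block e + q is compared on both sides: its first s letters recur in block e +
    2q, the others are copied from the end of block e. This is what \<open>border\<close>
    excludes.\<close>
  have "take s (f (u (e + q))) = take s (f (u (e + q + q)))"
  proof (rule nth_equalityI)
    fix j assume "j < length (take s (f (u (e + q))))"
    then have j: "j < s" by simp
    have "q * k \<ge> k" using q0 by simp
    then have "?w ((e + q) * k + j) = ?w ((e + q) * k + j + p)"
      using j s by (intro w; unfold i q distrib_right; linarith)
    also have "(e + q) * k + j + p = (e + q + q) * k + j" by (simp add: q algebra_simps)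
    finally show "take s (f (u (e + q))) ! j = take s (f (u (e + q + q))) ! j"
      using j s by simp
  qed (simp add: len)
  moreover have "drop s (f (u (e + q))) = drop s (f (u e))"
  proof (rule nth_equalityI)
    fix j assume "j < length (drop s (f (u (e + q))))"
    then have j: "s + j < k" by (simp add: len)
    have "q * k \<ge> k" using q0 by simp
    then have "?w (e * k + (s + j)) = ?w (e * k + (s + j) + p)"
      using j by (intro w; unfold i q; linarith)
    also have "e * k + (s + j) + p = (e + q) * k + (s + j)" by (simp add: q algebra_simps)
    finally show "drop s (f (u (e + q))) ! j = drop s (f (u e)) ! j"
      using j by (simp add: len)
  qed (simp add: len)
  ultimately show False using border[OF first last, of s] s by auto
qed

theorem no_matches_upto:
  assumes "squarefree_upto N u" "5 \<le> N" "0 < p" "i + t p + p \<le> N * k"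
  shows "\<not> matches (uniform_image k f u) i p (t p)"
proof (cases "p < 2 * k - 1")
  case False
  then have "\<not> matches (uniform_image k f u) i p p"
    using assms t_ge[of p] by (intro long_period[of N]) auto
  then show ?thesis using matches_mono t_ge by blast
qed (use assms short_period in blast)

corollary no_matches:
  assumes "\<And>N. squarefree_upto N u" "0 < p"
  shows "\<not> matches (uniform_image k f u) i p (t p)"
proof (rule no_matches_upto[of "5 + i + t p + p"])
  have "5 + i + t p + p \<le> (5 + i + t p + p) * k" using k_pos by simp
  then show "i + t p + p \<le> (5 + i + t p + p) * k" by linarith
qed (use assms in auto)

end

section \<open>A squarefree ternary word\<close>

fun sqf_morphism :: "letter \<Rightarrow> letter list" where
  "sqf_morphism A = [A,B,A,C,A,B,C,B,A,B,C]"
| "sqf_morphism B = [A,C,B,A,B,C,B,A,C,B,C]"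
| "sqf_morphism C = [A,C,B,A,C,A,B,A,C,B,C]"

lemma length_sqf: "\<forall>a\<in>set letters. length (sqf_morphism a) = 11"
  by code_simp

lemma sync_sqf: "\<forall>a\<in>set letters. \<forall>b\<in>set letters. \<forall>c\<in>set letters. a \<noteq> b \<longrightarrow>
    (\<forall>r\<in>set [1..<11]. take 11 (drop r (sqf_morphism a @ sqf_morphism b)) \<noteq> sqf_morphism c)"
  by code_simp

lemma border_sqf: "\<forall>a\<in>set letters. \<forall>b\<in>set letters. \<forall>c\<in>set letters. a \<noteq> b \<longrightarrow> b \<noteq> c \<longrightarrow>
    (\<forall>r\<in>set [0..<11]. take r (sqf_morphism b) = take r (sqf_morphism c) \<longrightarrow>
      drop r (sqf_morphism b) \<noteq> drop r (sqf_morphism a))"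
  by code_simp

lemma avoids_sqf: "\<forall>v\<in>set words5. avoids (\<lambda>p. p) (2 * 11 - 1) (concat (map sqf_morphism v))"
  by code_simp

interpretation sqf: uniform_morphism sqf_morphism 11 "\<lambda>p. p"
proof unfold_locales
  show "length (sqf_morphism a) = 11" for a
    using length_sqf by simp
  show "take 11 (drop r (sqf_morphism a @ sqf_morphism b)) \<noteq> sqf_morphism c"
    if "a \<noteq> b" "r \<in> {1..<11}" for a b c r
    using sync_sqf that by simp
  show "drop r (sqf_morphism b) \<noteq> drop r (sqf_morphism a)"
    if "a \<noteq> b" "b \<noteq> c" "r \<in> {0..<11}" "take r (sqf_morphism b) = take r (sqf_morphism c)"
    for a b c r
    using border_sqf that by simp
  show "avoids (\<lambda>p. p) (2 * 11 - 1) (concat (map sqf_morphism v))" if "v \<in> set words5" for v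
    using avoids_sqf that by blast
qed simp_all

text \<open>Taking the whole first block as base case keeps index 0 from calling itself.\<close>

function sqf_word :: "letter word" where
  "sqf_word n = sqf_morphism (if n < 11 then A else sqf_word (n div 11)) ! (n mod 11)"
  by auto
termination by (relation "measure id") auto

declare sqf_word.simps [simp del]

lemma sqf_word_less: "n < 11 \<Longrightarrow> sqf_word n = sqf_morphism A ! n"
  by (subst sqf_word.simps) simp

lemma sqf_word_fixpoint: "sqf_word = uniform_image 11 sqf_morphism sqf_word"
proof
  show "sqf_word n = uniform_image 11 sqf_morphism sqf_word n" for n
    by (subst sqf_word.simps) (simp add: uniform_image_def sqf_word_less)
qed

lemma squarefree_sqf_word: "squarefree_upto N sqf_word"
proof (induction N rule: less_induct)
  case (less N)
  show ?case
  proof (cases "N \<le> 5")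
    case True
    have u: "sqf_word 0 = A" "sqf_word 1 = B" "sqf_word 2 = A" "sqf_word 3 = C" "sqf_word 4 = A"
      by (simp_all add: sqf_word_less)
    have "\<not> matches sqf_word i p p" if "0 < p" "i + 2 * p \<le> 5" for i p
    proof -
      have "(p, i) \<in> {(1,0),(1,1),(1,2),(1,3),(2,0),(2,1)}" using that by auto
      then show ?thesis using u by (auto simp: matches_def numeral_eq_Suc less_Suc_eq)
    qed
    then show ?thesis using True by (auto simp: squarefree_upto_def)
  next
    case False
    \<comment> \<open>The first M letters have an image covering the first N. The 5 is required by
      \<open>no_matches_upto\<close>, and N > 5 gives M < N.\<close>
    define M where "M = max 5 ((N + 10) div 11)"
    have M: "M < N" "N \<le> M * 11" using False by (auto simp: M_def)
    have "\<not> matches (uniform_image 11 sqf_morphism sqf_word) i p p" if "0 < p" "i + 2 * p \<le> N" for i p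
      using sqf.no_matches_upto[OF less.IH[OF M(1)], of p i] that M by (auto simp: M_def)
    then show ?thesis by (simp add: squarefree_upto_def flip: sqf_word_fixpoint)
  qed
qed

section \<open>The two 49-uniform morphisms\<close>

fun base_morphism :: "letter \<Rightarrow> nat list" where
  "base_morphism A =
     [1,1,0,1,0,1,1,0,0,1,0,1,0,0,1,0,1,1,0,0,1,0,0,1,1,
      0,1,0,0,1,0,1,1,0,0,1,1,0,1,0,1,1,0,0,1,0,1,0,0]"
| "base_morphism B =
     [1,1,0,1,0,1,1,0,1,0,0,1,1,0,0,1,0,1,0,0,1,0,1,1,0,
      0,1,0,0,1,1,0,1,0,1,1,0,1,0,0,1,1,0,0,1,0,1,0,0]"
| "base_morphism C =
     [1,1,0,1,1,0,0,1,0,0,1,1,0,1,0,0,1,0,1,1,0,0,1,0,0,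
      1,1,0,1,1,0,0,1,0,1,1,0,1,0,0,1,1,0,0,1,0,1,0,0]"

fun curling_morphism :: "letter \<Rightarrow> nat list" where
  "curling_morphism A =
     [1,2,1,1,2,2,2,1,2,1,1,2,2,2,1,2,2,2,1,2,1,1,2,2,2,
      1,1,2,2,1,2,2,2,1,2,1,2,2,1,2,2,2,1,2,1,1,2,2,2]"
| "curling_morphism B =
     [1,2,1,1,2,2,2,1,2,2,2,1,2,1,2,2,1,2,2,2,1,2,2,2,1,
      2,1,1,2,2,2,1,1,2,2,2,1,2,2,2,1,2,1,2,2,1,2,2,2]"
| "curling_morphism C =
     [1,2,1,1,2,2,2,1,1,2,2,2,1,1,2,2,1,2,2,2,1,2,1,1,2,
      2,2,1,1,2,2,2,1,1,2,2,1,2,2,2,1,2,1,2,2,1,2,2,2]"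

text \<open>Boolean letters make the computations by rewriting about twice as fast as numerals.\<close>

definition base_bits :: "letter \<Rightarrow> bool list" where
  "base_bits a = map ((=) 1) (base_morphism a)"

definition curling_bits :: "letter \<Rightarrow> bool list" where
  "curling_bits a = map ((=) 2) (curling_morphism a)"

text \<open>With \<open>n\<close> matches the exponent is \<open>n / p + 1\<close>, so the first cases are the least \<open>n\<close> giving an
  exponent above \<open>5/2\<close> and \<open>3\<close>; the periods of the squares that do occur are at most 5 and 42.\<close>

definition base_bound :: "nat \<Rightarrow> nat" where
  "base_bound p = (if p \<le> 5 then Suc (p + p div 2) else p)"

definition curling_bound :: "nat \<Rightarrow> nat" where
  "curling_bound p = (if p \<le> 42 then 2 * p + 1 else p)"

lemma length_base: "length (base_morphism a) = 49"
  by (cases a) simp_all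

lemma sync_base: "\<forall>a\<in>set letters. \<forall>b\<in>set letters. \<forall>c\<in>set letters. a \<noteq> b \<longrightarrow>
    (\<forall>r\<in>set [1..<49]. take 49 (drop r (base_bits a @ base_bits b)) \<noteq> base_bits c)"
  by code_simp

lemma border_base: "\<forall>a\<in>set letters. \<forall>b\<in>set letters. \<forall>c\<in>set letters. a \<noteq> b \<longrightarrow> b \<noteq> c \<longrightarrow>
    (\<forall>r\<in>set [0..<49]. take r (base_bits b) = take r (base_bits c) \<longrightarrow>
      drop r (base_bits b) \<noteq> drop r (base_bits a))"
  by code_simp

lemma avoids_base: "\<forall>v\<in>set words5. avoids base_bound (2 * 49 - 1) (concat (map base_bits v))"
  by code_simp

interpretation base: uniform_morphism base_bits 49 base_bound
proof unfold_locales
  show "length (base_bits a) = 49" for a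
    by (simp add: base_bits_def length_base)
  show "take 49 (drop r (base_bits a @ base_bits b)) \<noteq> base_bits c"
    if "a \<noteq> b" "r \<in> {1..<49}" for a b c r
    using sync_base that by simp
  show "drop r (base_bits b) \<noteq> drop r (base_bits a)"
    if "a \<noteq> b" "b \<noteq> c" "r \<in> {0..<49}" "take r (base_bits b) = take r (base_bits c)" for a b c r
    using border_base that by simp
  show "avoids base_bound (2 * 49 - 1) (concat (map base_bits v))" if "v \<in> set words5" for v
    using avoids_base that by blast
  show "base_bound p + p \<le> 4 * 49" if "p < 2 * 49 - 1" for p
    using that by (auto simp: base_bound_def)
  show "p \<le> base_bound p" for p
    by (simp add: base_bound_def)
qed simp

lemma length_curling: "length (curling_morphism a) = 49"
  by (cases a) simp_all

lemma sync_curling: "\<forall>a\<in>set letters. \<forall>b\<in>set letters. \<forall>c\<in>set letters. a \<noteq> b \<longrightarrow>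
    (\<forall>r\<in>set [1..<49]. take 49 (drop r (curling_bits a @ curling_bits b)) \<noteq> curling_bits c)"
  by code_simp

lemma border_curling: "\<forall>a\<in>set letters. \<forall>b\<in>set letters. \<forall>c\<in>set letters. a \<noteq> b \<longrightarrow> b \<noteq> c \<longrightarrow>
    (\<forall>r\<in>set [0..<49]. take r (curling_bits b) = take r (curling_bits c) \<longrightarrow>
      drop r (curling_bits b) \<noteq> drop r (curling_bits a))"
  by code_simp

lemma avoids_curling: "\<forall>v\<in>set words5. avoids curling_bound (2 * 49 - 1) (concat (map curling_bits v))"
  by code_simp

interpretation curling: uniform_morphism curling_bits 49 curling_bound
proof unfold_locales
  show "length (curling_bits a) = 49" for a
    by (simp add: curling_bits_def length_curling)
  show "take 49 (drop r (curling_bits a @ curling_bits b)) \<noteq> curling_bits c"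
    if "a \<noteq> b" "r \<in> {1..<49}" for a b c r
    using sync_curling that by simp
  show "drop r (curling_bits b) \<noteq> drop r (curling_bits a)"
    if "a \<noteq> b" "b \<noteq> c" "r \<in> {0..<49}" "take r (curling_bits b) = take r (curling_bits c)" for a b c r
    using border_curling that by simp
  show "avoids curling_bound (2 * 49 - 1) (concat (map curling_bits v))" if "v \<in> set words5" for v
    using avoids_curling that by blast
  show "curling_bound p + p \<le> 4 * 49" if "p < 2 * 49 - 1" for p
    using that by (auto simp: curling_bound_def)
  show "p \<le> curling_bound p" for p
    by (simp add: curling_bound_def)
qed simp

section \<open>Exponents and curling numbers\<close>

text \<open>The least period is one of the periods p, so a bound on repetitions of every period
  suffices.\<close>

lemma plus_freeI:
  assumes "\<And>i p n. 0 < p \<Longrightarrow> matches w i p n \<Longrightarrow> real (n + p) \<le> \<alpha> * real p"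
  shows "plus_free \<alpha> w"
  unfolding plus_free_def
proof (intro notI, elim exE conjE)
  fix x i j
  assume x: "x = (w [i \<rightarrow> j])" "x \<noteq> []" and gt: "exponent x > \<alpha>"
  define p where "p = (LEAST p. has_period p x)"
  have "has_period (length x) x" using x(2) by (simp add: has_period_def Suc_le_eq)
  then have p: "has_period p x" unfolding p_def by (rule LeastI)
  then have p0: "0 < p" "p \<le> length x" by (auto simp: has_period_def)
  have "matches w i p (length x - p)"
    unfolding matches_def
  proof (intro allI impI)
    fix l assume l: "l < length x - p"
    then have "x ! l = x ! (l + p)" using p by (simp add: has_period_def)
    then show "w (i + l) = w (i + l + p)"
      using l by (simp add: x(1) subsequence_def add.assoc)
  qed
  from assms[OF p0(1) this] p0 have "real (length x) \<le> \<alpha> * real p" by simp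
  then have "exponent x \<le> \<alpha>"
    using p0 by (simp add: exponent_def p_def[symmetric] divide_le_eq)
  then show False using gt by simp
qed

text \<open>Position i is the last letter of the square; the bound on 2p keeps the subtraction from
  truncating.\<close>

definition square_ends :: "'a word \<Rightarrow> nat \<Rightarrow> nat \<Rightarrow> bool" where
  "square_ends w i p \<longleftrightarrow> 0 < p \<and> 2 * p \<le> Suc i \<and> matches w (Suc i - 2 * p) p p"

lemma square_endsD: "square_ends w i p \<Longrightarrow> 0 < p" "square_ends w i p \<Longrightarrow> 2 * p \<le> Suc i"
  by (simp_all add: square_ends_def)

lemma matches_of_power_suffix:
  assumes "map w [0..<n] = y @ concat (replicate k z)"
  shows "length y + k * length z = n" "matches w (length y) (length z) ((k - 1) * length z)"
proof -
  have "length (map w [0..<n]) = length y + k * length z"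
    unfolding assms by (simp add: length_concat sum_list_replicate)
  then show n: "length y + k * length z = n" by simp
  have nth: "w (length y + x) = z ! (x mod length z)" if "x < k * length z" for x
  proof -
    have "w (length y + x) = map w [0..<n] ! (length y + x)" using that n by simp
    also have "\<dots> = concat (replicate k z) ! x" unfolding assms by simp
    \<comment> \<open>The power is read as the image of a unary word, so that
      \<open>nth_concat_uniform\<close> applies.\<close>
    also have "\<dots> = concat (map (\<lambda>_. z) (replicate k ())) ! x" by simp
    also have "\<dots> = z ! (x mod length z)" using that by (subst nth_concat_uniform) simp_all
    finally show ?thesis .
  qed
  show "matches w (length y) (length z) ((k - 1) * length z)"
    unfolding matches_def
  proof (intro allI impI)
    fix j assume j: "j < (k - 1) * length z"
    then have "j + length z < k * length z" by (cases k) auto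
    then show "w (length y + j) = w (length y + j + length z)"
      using nth[of j] nth[of "j + length z"] by (simp add: add.assoc)
  qed
qed

text \<open>A suffix power with exponent above 2 contains a cube, so only the presence of a square
  suffix matters.\<close>

lemma curling_transform_cube_free:
  assumes "\<And>i p. 0 < p \<Longrightarrow> \<not> matches w i p (2 * p)"
  shows "curling_transform w i = (if \<exists>p. square_ends w i p then 2 else 1)"
proof -
  define u where "u = map w [0..<Suc i]"
  define P where "P k \<longleftrightarrow> 1 \<le> k \<and> (\<exists>y z. z \<noteq> [] \<and> u = y @ concat (replicate k z))" for k
  have le2: "k \<le> 2" if "P k" for k
  proof (rule ccontr)
    assume k: "\<not> k \<le> 2"
    obtain y z where z: "z \<noteq> []" "u = y @ concat (replicate k z)"
      using \<open>P k\<close> by (auto simp: P_def)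
    have "matches w (length y) (length z) ((k - 1) * length z)"
      using matches_of_power_suffix(2) z(2) unfolding u_def by metis
    moreover have "2 * length z \<le> (k - 1) * length z" using k by (intro mult_le_mono1) simp
    ultimately show False using assms z(1) matches_mono by (metis length_greater_0_conv)
  qed
  have P2: "\<exists>p. square_ends w i p" if P: "P 2"
  proof -
    obtain y z where z: "z \<noteq> []" "u = y @ concat (replicate 2 z)"
      using P by (auto simp: P_def)
    note m = matches_of_power_suffix[OF z(2)[unfolded u_def]]
    from m(1) have "Suc i - 2 * length z = length y" by linarith
    then have "square_ends w i (length z)"
      using z(1) m by (auto simp: square_ends_def)
    then show ?thesis by blast
  qed
  have "P 2" if sq: "square_ends w i p" for p
  proof -
    have p: "0 < p" "2 * p \<le> Suc i" and m: "matches w (Suc i - 2 * p) p p"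
      using sq by (auto simp: square_ends_def)
    define z where "z = drop (Suc i - p) u"
    have "take p (drop (Suc i - 2 * p) u) = z"
    proof (rule nth_equalityI)
      fix j assume "j < length (take p (drop (Suc i - 2 * p) u))"
      then have j: "j < p" by simp
      have "Suc i - 2 * p + j + p = Suc i - p + j" using p by simp
      then have "w (Suc i - 2 * p + j) = w (Suc i - p + j)"
        using m j unfolding matches_def by metis
      moreover have "Suc i - 2 * p + j < Suc i" "Suc i - p + j < Suc i" using j p by linarith+
      ultimately show "take p (drop (Suc i - 2 * p) u) ! j = z ! j"
        using j p by (simp add: z_def u_def del: upt_Suc)
    qed (use p in \<open>simp add: z_def u_def\<close>)
    moreover have "drop p (drop (Suc i - 2 * p) u) = z"
      using p by (simp add: z_def)
    ultimately have "drop (Suc i - 2 * p) u = z @ z"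
      by (metis append_take_drop_id)
    then have "u = take (Suc i - 2 * p) u @ z @ z"
      by (metis append_take_drop_id)
    moreover have "z \<noteq> []" using p by (simp add: z_def u_def)
    ultimately show ?thesis unfolding P_def by (auto simp: numeral_2_eq_2)
  qed
  moreover have "P 1" unfolding P_def by (auto simp: u_def)
  ultimately have "(GREATEST k. P k) = (if \<exists>p. square_ends w i p then 2 else 1)"
    using le2 P2 by (auto intro!: Greatest_equality) (metis One_nat_def Suc_1 le_SucE)
  then show ?thesis
    by (simp add: curling_transform_def curling_number_def P_def u_def subsequence_def del: upt_Suc)
qed

section \<open>The curling transform of the base word\<close>

definition short_square_ends :: "'a list \<Rightarrow> nat \<Rightarrow> bool" where
  "short_square_ends x i \<longleftrightarrow> (\<exists>p\<in>set [1..<6]. 2 * p \<le> Suc i \<and>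
     take p (drop (Suc i - 2 * p) x) = take p (drop (Suc i - p) x))"

lemma short_square_ends_iff: "short_square_ends x i \<longleftrightarrow> (\<exists>p. 0 < p \<and> p < 6 \<and> 2 * p \<le> Suc i \<and>
    take p (drop (Suc i - 2 * p) x) = take p (drop (Suc i - p) x))"
  unfolding short_square_ends_def Bex_def set_upt atLeastLessThan_iff One_nat_def Suc_le_eq conj_assoc
  by (rule refl)

lemma square_ends_window:
  assumes w: "\<And>l. l < length x \<Longrightarrow> w (d + l) = x ! l"
    and i: "i < length x" and p: "0 < p" "2 * p \<le> Suc i"
  shows "square_ends w (d + i) p \<longleftrightarrow>
    take p (drop (Suc i - 2 * p) x) = take p (drop (Suc i - p) x)"
proof -
  define b where "b = Suc i - 2 * p"
  have b: "Suc i = b + 2 * p" using p by (simp add: b_def)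
  then have "Suc (d + i) - 2 * p = d + b" "Suc i - 2 * p = b" "Suc i - p = b + p" by simp_all
  moreover have "w (d + b + j) = x ! (b + j)" "w (d + b + j + p) = x ! (b + p + j)" if "j < p" for j
    using w[of "b + j"] w[of "b + p + j"] b i that by (simp_all add: add.assoc add.commute[of j])
  ultimately show ?thesis
    using b i p by (auto simp: square_ends_def matches_def list_eq_iff_nth_eq add_ac)
qed

lemma curling_morphism_inside:
  "\<forall>b\<in>set letters. \<forall>r\<in>set [0..<49].
     curling_morphism b ! r = (if short_square_ends (base_morphism b) r then 2 else 1)"
  by code_simp

text \<open>A square of period at most 5 reaches back at most nine letters, so one preceding block
  is enough context; its letter differs from b because the ternary word is squarefree.\<close>

lemma curling_morphism_across:
  "\<forall>a\<in>set letters. \<forall>b\<in>set letters. a \<noteq> b \<longrightarrow> (\<forall>r\<in>set [0..<49].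
     curling_morphism b ! r =
       (if short_square_ends (base_morphism a @ base_morphism b) (49 + r) then 2 else 1))"
  by code_simp

definition base_word :: "nat word" where
  "base_word = uniform_image 49 base_morphism sqf_word"

lemma base_word_matches: "0 < p \<Longrightarrow> \<not> matches base_word i p (base_bound p)"
  using base.no_matches[OF squarefree_sqf_word] matches_uniform_image_map[of 49 base_morphism]
  unfolding base_word_def base_bits_def by (metis length_base zero_less_numeral)

lemma base_word_matches_le:
  assumes "0 < p" "matches base_word i p n"
  shows "2 * n \<le> 3 * p"
proof (rule ccontr)
  assume "\<not> ?thesis"
  \<comment> \<open>For p up to 5 the bound is the least n with 2n > 3p; beyond that it is p, which
    is below n.\<close>
  then have "base_bound p \<le> n" by (auto simp: base_bound_def)
  then show False using assms base_word_matches matches_mono by blast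
qed

lemma curling_transform_base_word:
  "curling_transform base_word = uniform_image 49 curling_morphism sqf_word"
proof
  fix i
  \<comment> \<open>From period 6 on, \<open>base_bound p\<close> equals p, so every square is
    excluded.\<close>
  have short: "p < 6" if "square_ends base_word i p" for p
    using that base_word_matches[of p "Suc i - 2 * p"]
    by (auto simp: square_ends_def base_bound_def split: if_splits)
  define m where "m = i div 49"
  define r where "r = i mod 49"
  have i: "i = m * 49 + r" and r: "r < 49" by (simp_all add: m_def r_def)
  have "(\<exists>p. square_ends base_word i p) \<longleftrightarrow> curling_morphism (sqf_word m) ! r = 2"
  proof (cases m)
    case 0
    let ?x = "base_morphism (sqf_word 0)"
    have "base_word (0 + l) = ?x ! l" if "l < length ?x" for l
      using that by (simp add: base_word_def uniform_image_def length_base)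
    note win = square_ends_window[OF this, of i]
    have i': "i < length ?x" using i r 0 by (simp add: length_base)
    have "square_ends base_word i p \<longleftrightarrow> 0 < p \<and> p < 6 \<and> 2 * p \<le> Suc i \<and>
        take p (drop (Suc i - 2 * p) ?x) = take p (drop (Suc i - p) ?x)" for p
      using win[OF _ i', of p] short[of p] square_endsD[of base_word i p] by auto
    then have "(\<exists>p. square_ends base_word i p) \<longleftrightarrow> short_square_ends ?x r"
      using i 0 by (simp add: short_square_ends_iff)
    then show ?thesis using curling_morphism_inside r 0 by simp
  next
    case (Suc e)
    let ?x = "base_morphism (sqf_word e) @ base_morphism (sqf_word m)"
    have "base_word (e * 49 + l) = ?x ! l" if "l < length ?x" for l
      using that uniform_image_window[of base_morphism 49 l 2 sqf_word e]
      by (simp add: base_word_def length_base Suc upt_rec numeral_2_eq_2)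
    note win = square_ends_window[OF this, of "49 + r"]
    have i': "49 + r < length ?x" "i = e * 49 + (49 + r)"
      using i r Suc by (simp_all add: length_base)
    have "square_ends base_word i p \<longleftrightarrow> 0 < p \<and> p < 6 \<and> 2 * p \<le> Suc (49 + r) \<and>
        take p (drop (Suc (49 + r) - 2 * p) ?x) = take p (drop (Suc (49 + r) - p) ?x)" for p
      using win[OF _ i'(1), of p] short[of p] square_endsD(1)[of base_word i p]
      unfolding i'(2) by auto
    then have "(\<exists>p. square_ends base_word i p) \<longleftrightarrow> short_square_ends ?x (49 + r)"
      unfolding short_square_ends_iff by (rule ex_cong1)
    moreover have "sqf_word e \<noteq> sqf_word m"
    proof
      assume "sqf_word e = sqf_word m"
      then have "matches sqf_word e 1 1" by (simp add: matches_def Suc)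
      then show False using squarefree_sqf_word[of "e + 2"] by (auto simp: squarefree_upto_def)
    qed
    ultimately show ?thesis using curling_morphism_across r by simp
  qed
  \<comment> \<open>With only two possible values, knowing when the letter is 2 determines
    it.\<close>
  moreover have "curling_morphism (sqf_word m) ! r \<in> {1, 2}"
    using curling_morphism_inside r by simp
  moreover have "uniform_image 49 curling_morphism sqf_word i = curling_morphism (sqf_word m) ! r"
    by (simp add: uniform_image_def m_def r_def)
  moreover have "\<not> matches base_word j p (2 * p)" if "0 < p" for j p
    using base_word_matches_le[of p j "2 * p"] that by auto
  ultimately show "curling_transform base_word i = uniform_image 49 curling_morphism sqf_word i"
    by (subst curling_transform_cube_free) auto
qed

theorem theorem5:
  shows "\<exists>w :: nat word. range w \<subseteq> {0, 1} \<and>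
           plus_free (5 / 2) w \<and> plus_free 3 (curling_transform w)"
proof (intro exI conjI)
  have "set (base_morphism a) \<subseteq> {0, 1}" for a by (cases a) auto
  moreover have "base_word n \<in> set (base_morphism (sqf_word (n div 49)))" for n
    unfolding base_word_def uniform_image_def by (rule nth_mem) (simp add: length_base)
  ultimately show "range base_word \<subseteq> {0, 1}"
    unfolding image_subset_iff by (metis subsetD)
  show "plus_free (5 / 2) base_word"
  proof (rule plus_freeI)
    fix i p n assume "0 < p" "matches base_word i p n"
    then have "real (2 * n) \<le> real (3 * p)"
      using base_word_matches_le of_nat_le_iff by blast
    then show "real (n + p) \<le> 5 / 2 * real p" by simp
  qed
  show "plus_free 3 (curling_transform base_word)"
    unfolding curling_transform_base_word
  proof (rule plus_freeI)
    fix i p n assume p: "0 < p" and m: "matches (uniform_image 49 curling_morphism sqf_word) i p n"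
    have "n \<le> 2 * p"
    proof (rule ccontr)
      assume "\<not> n \<le> 2 * p"
      then have "curling_bound p \<le> n" by (auto simp: curling_bound_def)
      moreover have "matches (uniform_image 49 curling_bits sqf_word) i p n"
        unfolding curling_bits_def by (rule matches_uniform_image_map[OF m length_curling]) simp
      ultimately show False
        using curling.no_matches[OF squarefree_sqf_word p] matches_mono by blast
    qed
    then show "real (n + p) \<le> 3 * real p" by simp
  qed
qed

end
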